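(* Let $0<q\le 1$. For $w_1\in\mathbb{D}$ put $\mathcal{S}_{w_1}=\{w_2\in\mathbb{D}:\langle\hat{k}_{w_1},\hat{k}_{w_2}\rangle=q\}$. Then: (i) $\mathcal{S}_0=\mathbb{T}_{\sqrt{1-q^2}}$, and for every $w_1\in\mathbb{D}$ with $w_1\neq 0$, $\mathcal{S}_{w_1}=\{\lambda^+_{w_1}w_1,\lambda^-_{w_1}w_1\}\subseteq\mathbb{D}$, where $$\lambda^{\pm}_{w_1}=\frac{|w_1|q^2\pm(1-|w_1|^2)\sqrt{1-q^2}}{|w_1|\left(1-(1-q^2)|w_1|^2\right)}.$$ (ii) $\bigcup_{w_1\in\mathbb{D}}\mathcal{S}_{w_1}=\mathbb{D}$.
   Context: $\mathbb{D}$ is the open unit disc in $\mathbb{C}$ and $\mathbb{T}_r$ is the circle of radius $r$ centered at the origin (with $\mathbb{T}_0=\{0\}$). $H^2(\mathbb{D})$ is the Hardy space of analytic functions $f(z)=\sum_{n\ge0}a_nz^n$ on $\mathbb{D}$ with $\sum|a_n|^2<\infty$, with inner product $\langle\sum a_nz^n,\sum b_nz^n\rangle=\sum a_n\overline{b_n}$. Its reproducing kernel at $w\in\mathbb{D}$ is $k_w(z)=\frac{1}{1-\overline{w}z}$, with $\|k_w\|^2=(1-|w|^2)^{-1}$, and $\hat{k}_w=k_w/\|k_w\|$ is the normalized reproducing kernel. *)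

theory Defs
  imports "HOL-Complex_Analysis.Complex_Analysis"
begin

text \<open>
  The elements of the Hardy space are represented by functions of type \<^typ>\<open>complex \<Rightarrow> complex\<close>
  that are holomorphic on the unit disc; their values outside the disc are irrelevant.  The
  coefficients \<open>a\<^sub>n\<close> of \<open>f(z) = \<Sum> a\<^sub>n z\<^sup>n\<close> are those of the Taylor expansion of \<open>f\<close> at 0.
\<close>

abbreviation unit_disc :: "complex set" where
  "unit_disc \<equiv> ball 0 1"

definition taylor_coeff :: "(complex \<Rightarrow> complex) \<Rightarrow> nat \<Rightarrow> complex" where
  "taylor_coeff f n = fps_nth (fps_expansion f 0) n"

definition hardy2 :: "(complex \<Rightarrow> complex) set" where
  "hardy2 = {f. f holomorphic_on unit_disc \<and> summable (\<lambda>n. (cmod (taylor_coeff f n))\<^sup>2)}"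

text \<open>The following two are meaningful for arguments in \<^const>\<open>hardy2\<close>.\<close>

definition hardy_inner :: "(complex \<Rightarrow> complex) \<Rightarrow> (complex \<Rightarrow> complex) \<Rightarrow> complex" where
  "hardy_inner f g = (\<Sum>n. taylor_coeff f n * cnj (taylor_coeff g n))"

definition hardy_norm :: "(complex \<Rightarrow> complex) \<Rightarrow> real" where
  "hardy_norm f = sqrt (Re (hardy_inner f f))"

definition hardy_kernel :: "complex \<Rightarrow> complex \<Rightarrow> complex" where
  "hardy_kernel w = (\<lambda>z. 1 / (1 - cnj w * z))"

definition normalized_kernel :: "complex \<Rightarrow> complex \<Rightarrow> complex" where
  "normalized_kernel w = (\<lambda>z. hardy_kernel w z / of_real (hardy_norm (hardy_kernel w)))"

definition kernel_level_set :: "real \<Rightarrow> complex \<Rightarrow> complex set" where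
  "kernel_level_set q w1 =
     {w2 \<in> unit_disc. hardy_inner (normalized_kernel w1) (normalized_kernel w2) = of_real q}"

definition lambda_plus :: "real \<Rightarrow> complex \<Rightarrow> real" where
  "lambda_plus q w =
     (cmod w * q\<^sup>2 + (1 - (cmod w)\<^sup>2) * sqrt (1 - q\<^sup>2)) / (cmod w * (1 - (1 - q\<^sup>2) * (cmod w)\<^sup>2))"

definition lambda_minus :: "real \<Rightarrow> complex \<Rightarrow> real" where
  "lambda_minus q w =
     (cmod w * q\<^sup>2 - (1 - (cmod w)\<^sup>2) * sqrt (1 - q\<^sup>2)) / (cmod w * (1 - (1 - q\<^sup>2) * (cmod w)\<^sup>2))"

text \<open>
  The functions \<^const>\<open>hardy_kernel\<close> lie in the Hardy space, have the reproducing property there, and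
  have the expected norm.
\<close>

lemma taylor_coeff_kernel: "taylor_coeff (hardy_kernel w) n = cnj w ^ n"
proof -
  have "hardy_kernel w has_fps_expansion (1 / (1 - fps_const (cnj w) * fps_X))"
    unfolding hardy_kernel_def by (intro fps_expansion_intros) auto
  moreover have "(1 / (1 - fps_const (cnj w) * fps_X) :: complex fps) = Abs_fps (\<lambda>n. cnj w ^ n)"
  proof -
    have "Abs_fps (\<lambda>n. cnj w ^ n) * (1 - fps_const (cnj w) * fps_X) = 1"
    proof (rule fps_ext)
      fix n
      show "fps_nth (Abs_fps (\<lambda>n. cnj w ^ n) * (1 - fps_const (cnj w) * fps_X)) n = fps_nth 1 n"
        by (cases n) (simp_all add: right_diff_distrib mult.left_commute[of _ "fps_const _"])
    qed
    hence "inverse (1 - fps_const (cnj w) * fps_X) = Abs_fps (\<lambda>n. cnj w ^ n)"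
      by (intro fps_inverse_unique) (simp add: mult.commute)
    thus ?thesis
      by (simp add: fps_divide_unit)
  qed
  ultimately have "hardy_kernel w has_fps_expansion Abs_fps (\<lambda>n. cnj w ^ n)" by simp
  from fps_nth_fps_expansion[OF this, of n] show ?thesis
    by (simp add: taylor_coeff_def fps_expansion_def)
qed

lemma kernel_in_hardy2:
  assumes "w \<in> unit_disc"
  shows "hardy_kernel w \<in> hardy2"
proof -
  have w: "cmod w < 1" using assms by simp
  have "1 - cnj w * z \<noteq> 0" if "cmod z < 1" for z
  proof
    assume "1 - cnj w * z = 0"
    hence "cmod (cnj w * z) = 1" by simp
    moreover have "cmod w * cmod z < 1 * 1"
      using w that by (intro mult_strict_mono') auto
    ultimately show False by (simp add: norm_mult)
  qed
  hence "hardy_kernel w holomorphic_on unit_disc"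
    unfolding hardy_kernel_def by (intro holomorphic_intros) auto
  moreover have "summable (\<lambda>n. ((cmod w)\<^sup>2) ^ n)"
    using w by (intro summable_geometric) (simp add: abs_square_less_1)
  ultimately show ?thesis
    by (simp add: hardy2_def taylor_coeff_kernel norm_power mult.commute flip: power_mult)
qed

lemma hardy_inner_kernel:
  assumes "f \<in> hardy2" "w \<in> unit_disc"
  shows "hardy_inner f (hardy_kernel w) = f w"
proof -
  have "(\<lambda>n. (deriv ^^ n) f 0 / fact n * (w - 0) ^ n) sums f w"
    using assms by (intro holomorphic_power_series[of f 0 1]) (auto simp: hardy2_def)
  thus ?thesis
    unfolding hardy_inner_def taylor_coeff_kernel
    by (simp add: taylor_coeff_def fps_expansion_def sums_iff)
qed

lemma hardy_norm_kernel:
  assumes "w \<in> unit_disc"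
  shows "(hardy_norm (hardy_kernel w))\<^sup>2 = inverse (1 - (cmod w)\<^sup>2)"
proof -
  have "hardy_inner (hardy_kernel w) (hardy_kernel w) = 1 / (1 - cnj w * w)"
    using hardy_inner_kernel[OF kernel_in_hardy2 assms] assms by (simp add: hardy_kernel_def)
  also have "\<dots> = of_real (inverse (1 - (cmod w)\<^sup>2))"
    by (simp add: mult.commute[of "cnj w"] complex_norm_square[symmetric] divide_inverse
        flip: of_real_power)
  finally have "Re (hardy_inner (hardy_kernel w) (hardy_kernel w)) = inverse (1 - (cmod w)\<^sup>2)"
    by (metis Re_complex_of_real)
  moreover have "(cmod w)\<^sup>2 \<le> 1"
    using assms by (simp add: abs_square_le_1)
  ultimately show ?thesis
    by (simp add: hardy_norm_def)
qed

end

theory Submission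
  imports Defs
begin

text \<open>
  By the reproducing property, \<open>w\<^sub>2 \<in> S\<^bsub>w\<^sub>1\<^esub>\<close> means
  \<open>sqrt ((1 - |w\<^sub>1|\<^sup>2) (1 - |w\<^sub>2|\<^sup>2)) = q (1 - cnj w\<^sub>1 w\<^sub>2)\<close>.  So \<open>cnj w\<^sub>1 w\<^sub>2\<close> is real, and for
  \<open>w\<^sub>1 \<noteq> 0\<close> one can write \<open>w\<^sub>2 = (u / r) w\<^sub>1\<close> with \<open>r = |w\<^sub>1|\<close> and \<open>-1 < u < 1\<close>.  Since
  \<open>(1 - r u)\<^sup>2 - (1 - r\<^sup>2) (1 - u\<^sup>2) = (u - r)\<^sup>2\<close>, the condition becomes
  \<open>u - r = \<plusminus> p (1 - r u)\<close> with \<open>p = sqrt (1 - q\<^sup>2)\<close>, that is,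
  \<open>u = (r \<plusminus> p) / (1 \<plusminus> p r)\<close>.  Part (ii) holds because the condition is symmetric and the
  level sets are nonempty.
\<close>

lemma taylor_coeff_cmult:
  assumes "f analytic_on {0}"
  shows "taylor_coeff (\<lambda>z. c * f z) n = c * taylor_coeff f n"
proof -
  have "(\<lambda>z. c * f z) has_fps_expansion fps_const c * fps_expansion f 0"
    using analytic_at_imp_has_fps_expansion_0[OF assms] by (intro fps_expansion_intros)
  from fps_nth_fps_expansion[OF this, of n] show ?thesis
    by (simp add: taylor_coeff_def fps_expansion_def)
qed

text \<open>\<open>taylor_coeff\<close> and \<open>suminf\<close> are total functions. Analyticity
  at 0 lets a scalar pass through the first, summability through the second.\<close>

lemma hardy_inner_cmult:
  assumes "f analytic_on {0}" "g analytic_on {0}"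
    and "summable (\<lambda>n. taylor_coeff f n * cnj (taylor_coeff g n))"
  shows "hardy_inner (\<lambda>z. a * f z) (\<lambda>z. b * g z) = a * cnj b * hardy_inner f g"
  using suminf_mult[OF assms(3), of "a * cnj b"]
  by (simp add: hardy_inner_def taylor_coeff_cmult assms(1,2) mult_ac)

lemma hardy_kernel_analytic_at_0: "hardy_kernel w analytic_on {0}"
  unfolding hardy_kernel_def by (intro analytic_intros) auto

lemma norm_cnj_mult_less_1:
  assumes "cmod w < 1" "cmod z < 1"
  shows "cmod (cnj w * z) < 1"
  using mult_strict_mono'[of "cmod w" 1 "cmod z" 1] assms by (simp add: norm_mult)

text \<open>The formula for the squared norm leaves the sign open, so the inner product is evaluated
  again. The inverse form turns normalization into multiplication by a scalar.\<close>

lemma inverse_hardy_norm_kernel: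
  assumes "w \<in> unit_disc"
  shows "inverse (hardy_norm (hardy_kernel w)) = sqrt (1 - (cmod w)\<^sup>2)"
proof -
  have "hardy_inner (hardy_kernel w) (hardy_kernel w) = 1 / (1 - cnj w * w)"
    using hardy_inner_kernel[OF kernel_in_hardy2[OF assms] assms] by (simp add: hardy_kernel_def)
  also have "\<dots> = of_real (inverse (1 - (cmod w)\<^sup>2))"
    by (simp add: mult.commute[of "cnj w"] complex_norm_square[symmetric] divide_inverse
        flip: of_real_power)
  finally have "hardy_norm (hardy_kernel w) = sqrt (inverse (1 - (cmod w)\<^sup>2))"
    by (metis hardy_norm_def Re_complex_of_real)
  thus ?thesis by (simp add: real_sqrt_inverse)
qed

lemma hardy_inner_normalized_kernel:
  assumes "w1 \<in> unit_disc" "w2 \<in> unit_disc"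
  shows "hardy_inner (normalized_kernel w1) (normalized_kernel w2) =
           of_real (sqrt ((1 - (cmod w1)\<^sup>2) * (1 - (cmod w2)\<^sup>2))) / (1 - cnj w1 * w2)"
proof -
  have normalized: "normalized_kernel w = (\<lambda>z. of_real (sqrt (1 - (cmod w)\<^sup>2)) * hardy_kernel w z)"
    if "w \<in> unit_disc" for w
    using that
    by (simp add: normalized_kernel_def fun_eq_iff divide_inverse mult.commute
        flip: inverse_hardy_norm_kernel)
  have "summable (\<lambda>n. (cnj w1 * w2) ^ n)"
    using assms norm_cnj_mult_less_1[of w1 w2] by (intro summable_geometric) auto
  hence "summable (\<lambda>n. taylor_coeff (hardy_kernel w1) n * cnj (taylor_coeff (hardy_kernel w2) n))"
    by (simp add: taylor_coeff_kernel power_mult_distrib)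
  moreover have "hardy_inner (hardy_kernel w1) (hardy_kernel w2) = 1 / (1 - cnj w1 * w2)"
    using hardy_inner_kernel[OF kernel_in_hardy2[OF assms(1)] assms(2)]
    by (simp add: hardy_kernel_def)
  ultimately show ?thesis
    by (simp add: normalized[OF assms(1)] normalized[OF assms(2)] hardy_inner_cmult
        hardy_kernel_analytic_at_0 real_sqrt_mult)
qed

lemma mem_kernel_level_set_iff:
  assumes "w1 \<in> unit_disc"
  shows "w2 \<in> kernel_level_set q w1 \<longleftrightarrow> w2 \<in> unit_disc \<and>
           of_real (sqrt ((1 - (cmod w1)\<^sup>2) * (1 - (cmod w2)\<^sup>2))) = of_real q * (1 - cnj w1 * w2)"
proof (cases "w2 \<in> unit_disc")
  case True
  hence "1 - cnj w1 * w2 \<noteq> 0"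
    using norm_cnj_mult_less_1[of w1 w2] assms by auto
  thus ?thesis
    using True by (simp add: kernel_level_set_def hardy_inner_normalized_kernel[OF assms True]
        divide_eq_eq)
qed (simp add: kernel_level_set_def)

text \<open>Conjugation fixes the real left side of the defining equation and exchanges
  \<open>w1\<close> and \<open>w2\<close> on the right.\<close>

lemma kernel_level_set_sym:
  assumes "w2 \<in> kernel_level_set q w1" "w1 \<in> unit_disc"
  shows "w1 \<in> kernel_level_set q w2"
proof -
  from assms have w2: "w2 \<in> unit_disc"
    and "cnj (of_real (sqrt ((1 - (cmod w1)\<^sup>2) * (1 - (cmod w2)\<^sup>2)))) =
      cnj (of_real q * (1 - cnj w1 * w2))"
    by (simp_all add: mem_kernel_level_set_iff)
  with assms(2) show ?thesis
    by (simp add: mem_kernel_level_set_iff mult.commute)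
qed

lemma kernel_level_set_0:
  assumes "0 < q" "q \<le> 1"
  shows "kernel_level_set q 0 = sphere 0 (sqrt (1 - q\<^sup>2))"
proof (rule set_eqI)
  fix w :: complex
  have q2: "q\<^sup>2 \<le> 1" "0 < q\<^sup>2" using assms by (auto simp: power_le_one)
  have "w \<in> kernel_level_set q 0 \<longleftrightarrow> cmod w < 1 \<and> sqrt (1 - (cmod w)\<^sup>2) = q"
    by (simp add: mem_kernel_level_set_iff)
  also have "\<dots> \<longleftrightarrow> (cmod w)\<^sup>2 = 1 - q\<^sup>2"
  proof
    assume *: "cmod w < 1 \<and> sqrt (1 - (cmod w)\<^sup>2) = q"
    hence "q\<^sup>2 = 1 - (cmod w)\<^sup>2" by (auto simp: abs_square_le_1)
    thus "(cmod w)\<^sup>2 = 1 - q\<^sup>2" by simp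
  next
    assume *: "(cmod w)\<^sup>2 = 1 - q\<^sup>2"
    hence "(cmod w)\<^sup>2 < 1" using q2 by simp
    hence "cmod w < 1" by (simp add: abs_square_less_1)
    thus "cmod w < 1 \<and> sqrt (1 - (cmod w)\<^sup>2) = q"
      using * assms by simp
  qed
  also have "\<dots> \<longleftrightarrow> cmod w = sqrt (1 - q\<^sup>2)"
    using q2 by (metis diff_ge_0_iff_ge norm_ge_zero real_sqrt_pow2 real_sqrt_unique)
  finally show "w \<in> kernel_level_set q 0 \<longleftrightarrow> w \<in> sphere 0 (sqrt (1 - q\<^sup>2))"
    by simp
qed

text \<open>The equation places \<open>u\<close> at pseudo-hyperbolic distance \<open>p\<close> from
  \<open>r\<close>; a real point has one such real point on each side.\<close>

lemma sqrt_eq_level_iff: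
  fixes p q r u :: real
  assumes p: "0 \<le> p" "p < 1" "p\<^sup>2 = 1 - q\<^sup>2" and q: "0 < q"
    and r: "0 \<le> r" "r < 1" and u: "\<bar>u\<bar> < 1"
  shows "sqrt ((1 - r\<^sup>2) * (1 - u\<^sup>2)) = q * (1 - r * u) \<longleftrightarrow>
           u = (r + p) / (1 + p * r) \<or> u = (r - p) / (1 - p * r)"
proof -
  have "\<bar>r * u\<bar> < 1" using mult_strict_mono'[of "\<bar>r\<bar>" 1 "\<bar>u\<bar>" 1] r u by (simp add: abs_mult)
  hence ru: "1 - r * u > 0" by linarith
  have "r\<^sup>2 \<le> 1" "u\<^sup>2 \<le> 1" using r u by (auto simp: abs_square_le_1)
  hence nn: "(1 - r\<^sup>2) * (1 - u\<^sup>2) \<ge> 0" by simp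
  have pr: "1 + p * r > 0" "1 - p * r > 0"
    using mult_strict_mono'[of p 1 r 1] p r by (auto simp: add_pos_nonneg)
  \<comment> \<open>Squaring loses nothing because \<open>q * (1 - r * u)\<close> is
    nonnegative.\<close>
  have "sqrt ((1 - r\<^sup>2) * (1 - u\<^sup>2)) = q * (1 - r * u) \<longleftrightarrow>
      (1 - r\<^sup>2) * (1 - u\<^sup>2) = (q * (1 - r * u))\<^sup>2"
    using nn q ru
    by (metis mult_nonneg_nonneg less_eq_real_def real_sqrt_pow2 real_sqrt_unique)
  \<comment> \<open>Both sides are subtracted from \<open>(1 - r * u)\<^sup>2\<close>.\<close>
  also have "\<dots> \<longleftrightarrow> (u - r)\<^sup>2 = p\<^sup>2 * (1 - r * u)\<^sup>2"
    unfolding p(3) by (auto simp: power2_eq_square algebra_simps)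
  also have "\<dots> \<longleftrightarrow> u - r = p * (1 - r * u) \<or> u - r = - (p * (1 - r * u))"
    by (simp add: power2_eq_iff flip: power_mult_distrib)
  also have "\<dots> \<longleftrightarrow> u = (r + p) / (1 + p * r) \<or> u = (r - p) / (1 - p * r)"
    using pr by (auto simp: eq_divide_eq algebra_simps)
  finally show ?thesis .
qed

text \<open>The stated fractions are not in lowest terms: the denominator contains
  \<open>(1 + p * r) * (1 - p * r)\<close>, and each numerator shares one of these factors.\<close>

lemma lambda_eq:
  fixes p q :: real
  assumes "w \<noteq> 0" "cmod w < 1" and p: "p = sqrt (1 - q\<^sup>2)" "0 \<le> p" "p < 1" "p\<^sup>2 = 1 - q\<^sup>2"
  shows "lambda_plus q w = (cmod w + p) / (1 + p * cmod w) / cmod w"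
    and "lambda_minus q w = (cmod w - p) / (1 - p * cmod w) / cmod w"
proof -
  define r where "r = cmod w"
  have q2: "q\<^sup>2 = 1 - p\<^sup>2" using p by simp
  have r: "0 < r" "r < 1" using assms by (auto simp: r_def)
  have "0 \<le> p * r" "p * r < 1"
    using mult_strict_mono'[of p 1 r 1] p(2,3) r by auto
  hence pr: "1 + p * r \<noteq> 0" "1 - p * r \<noteq> 0" by auto
  have den: "1 - (1 - q\<^sup>2) * r\<^sup>2 = (1 + p * r) * (1 - p * r)"
    unfolding p(4)[symmetric] by (simp add: power2_eq_square algebra_simps)
  have "r * q\<^sup>2 + (1 - r\<^sup>2) * p = (r + p) * (1 - p * r)"
    unfolding q2 by (simp add: power2_eq_square algebra_simps)
  thus "lambda_plus q w = (cmod w + p) / (1 + p * cmod w) / cmod w"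
    using pr r by (simp add: lambda_plus_def den flip: r_def p(1))
  have "r * q\<^sup>2 - (1 - r\<^sup>2) * p = (r - p) * (1 + p * r)"
    unfolding q2 by (simp add: power2_eq_square algebra_simps)
  thus "lambda_minus q w = (cmod w - p) / (1 - p * cmod w) / cmod w"
    using pr r by (simp add: lambda_minus_def den flip: r_def p(1))
qed

lemma abs_mobius_less_1:
  fixes p r :: real
  assumes "\<bar>p\<bar> < 1" "\<bar>r\<bar> < 1"
  shows "\<bar>(r + p) / (1 + p * r)\<bar> < 1"
proof -
  \<comment> \<open>These products are the numerators of 1 minus and 1 plus the quotient, and their
    sum is twice its denominator.\<close>
  have "(1 - r) * (1 - p) > 0" "(1 + r) * (1 + p) > 0"
    using assms by (auto intro!: mult_pos_pos)
  moreover from this have "2 * (1 + p * r) > 0" by (simp add: algebra_simps)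
  ultimately show ?thesis by (simp add: abs_less_iff divide_simps algebra_simps)
qed

lemma kernel_level_set_nonzero:
  assumes q: "0 < q" "q \<le> 1" and w: "w \<in> unit_disc" "w \<noteq> 0"
  defines "L \<equiv> {of_real (lambda_plus q w) * w, of_real (lambda_minus q w) * w}"
  shows "kernel_level_set q w = L" and "L \<subseteq> unit_disc"
proof -
  define p where "p = sqrt (1 - q\<^sup>2)"
  define r where "r = cmod w"
  have r: "0 < r" "r < 1" using w by (auto simp: r_def)
  have q2: "q\<^sup>2 \<le> 1" "0 < q\<^sup>2" using q by (auto simp: power_le_one)
  hence p: "0 \<le> p" "p < 1" "p\<^sup>2 = 1 - q\<^sup>2" by (auto simp: p_def)
  \<comment> \<open>\<open>u p\<close> and \<open>u (- p)\<close> are the two roots, so one bound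
    covers both signs.\<close>
  define u where "u s = (r + s) / (1 + s * r)" for s
  have L: "L = {of_real (u p / r) * w, of_real (u (- p) / r) * w}"
    using lambda_eq[OF w(2) _ p_def p] r by (simp add: L_def u_def r_def)
  have norm_ray: "cmod (of_real (t / r) * w) = \<bar>t\<bar>" for t
    using r by (simp add: norm_mult norm_divide r_def)
  have u: "\<bar>u p\<bar> < 1" "\<bar>u (- p)\<bar> < 1"
    unfolding u_def using p(1,2) r by (intro abs_mobius_less_1; simp)+
  thus "L \<subseteq> unit_disc" unfolding L using norm_ray by auto
  have cnj_w: "cnj w * w = of_real (r\<^sup>2)"
    using complex_norm_square[of w] by (simp add: r_def mult.commute)
  \<comment> \<open>On the real line through 0 and \<open>w\<close>, the point with parameter
    \<open>t\<close> has modulus \<open>\<bar>t\<bar>\<close>, and its product with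
    \<open>cnj w\<close> is \<open>r * t\<close>. This leaves the real equation solved
    above.\<close>
  have on_ray: "of_real (t / r) * w \<in> kernel_level_set q w \<longleftrightarrow> t = u p \<or> t = u (- p)"
    if t: "\<bar>t\<bar> < 1" for t
  proof -
    have "cnj w * (of_real (t / r) * w) = of_real (t / r) * (cnj w * w)" by simp
    also have "\<dots> = of_real (r * t)" using r by (simp add: cnj_w power2_eq_square)
    finally have "of_real (t / r) * w \<in> kernel_level_set q w \<longleftrightarrow>
        (of_real (sqrt ((1 - r\<^sup>2) * (1 - t\<^sup>2))) :: complex) = of_real (q * (1 - r * t))"
      using w t norm_ray[of t]
      by (simp add: mem_kernel_level_set_iff r_def)
    also have "\<dots> \<longleftrightarrow> t = u p \<or> t = u (- p)"
      unfolding of_real_eq_iff using sqrt_eq_level_iff[OF p q(1) _ _ t, of r] r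
      by (simp add: u_def)
    finally show ?thesis .
  qed
  show "kernel_level_set q w = L"
  proof
    show "L \<subseteq> kernel_level_set q w" using on_ray u by (simp add: L)
    show "kernel_level_set q w \<subseteq> L"
    proof
      fix z assume z: "z \<in> kernel_level_set q w"
      hence z1: "cmod z < 1" by (simp add: kernel_level_set_def)
      define s where "s = sqrt ((1 - r\<^sup>2) * (1 - (cmod z)\<^sup>2))"
      have "of_real s = of_real q * (1 - cnj w * z)"
        using z w by (simp add: mem_kernel_level_set_iff s_def r_def)
      hence "cnj w * z = of_real (1 - s / q)" using q by (simp add: field_simps)
      \<comment> \<open>Multiplying the real number \<open>cnj w * z\<close> by \<open>w\<close>
        shows that \<open>z\<close> is a real multiple of \<open>w\<close>.\<close>
      hence "of_real (r\<^sup>2) * z = w * of_real (1 - s / q)"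
        by (metis cnj_w mult.assoc mult.commute)
      hence "z = of_real (((1 - s / q) / r) / r) * w"
        using r by (simp add: field_simps power2_eq_square)
      then obtain t where t: "z = of_real (t / r) * w" by blast
      with z1 norm_ray[of t] have "\<bar>t\<bar> < 1" by simp
      with on_ray[of t] z show "z \<in> L" by (auto simp: t L)
    qed
  qed
qed

lemma kernel_level_set_nonempty:
  assumes "0 < q" "q \<le> 1" "w \<in> unit_disc"
  shows "kernel_level_set q w \<noteq> {}"
proof (cases "w = 0")
  case True
  \<comment> \<open>This makes the radius nonnegative; \<open>sqrt\<close> of a negative number is
    negative and would give an empty sphere.\<close>
  have "q\<^sup>2 \<le> 1" using assms by (simp add: power_le_one)
  thus ?thesis using True assms by (simp add: kernel_level_set_0)
next
  case False
  thus ?thesis using kernel_level_set_nonzero(1)[OF assms False] by simp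
qed

theorem theorem2p2:
  fixes q :: real
  assumes "0 < q" and "q \<le> 1"
  shows "(kernel_level_set q 0 = sphere 0 (sqrt (1 - q\<^sup>2)) \<and>
          (\<forall>w1\<in>unit_disc. w1 \<noteq> 0 \<longrightarrow>
             kernel_level_set q w1 =
               {of_real (lambda_plus q w1) * w1, of_real (lambda_minus q w1) * w1} \<and>
             {of_real (lambda_plus q w1) * w1, of_real (lambda_minus q w1) * w1} \<subseteq> unit_disc)) \<and>
         (\<Union>w1\<in>unit_disc. kernel_level_set q w1) = unit_disc"
proof (intro conjI ballI impI)
  show "(\<Union>w1\<in>unit_disc. kernel_level_set q w1) = unit_disc"
  proof
    show "(\<Union>w1\<in>unit_disc. kernel_level_set q w1) \<subseteq> unit_disc"
      by (auto simp: kernel_level_set_def)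
    show "unit_disc \<subseteq> (\<Union>w1\<in>unit_disc. kernel_level_set q w1)"
    proof
      \<comment> \<open>Any \<open>z\<close> in the level set of \<open>w\<close> serves as the
        index: by symmetry its own level set contains \<open>w\<close>.\<close>
      fix w assume w: "w \<in> unit_disc"
      then obtain z where z: "z \<in> kernel_level_set q w"
        using kernel_level_set_nonempty[OF assms] by blast
      moreover from z have "z \<in> unit_disc" by (simp add: kernel_level_set_def)
      ultimately show "w \<in> (\<Union>w1\<in>unit_disc. kernel_level_set q w1)"
        using kernel_level_set_sym[OF z w] by blast
    qed
  qed
qed (use kernel_level_set_0[OF assms] kernel_level_set_nonzero[OF assms] in auto)

end
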